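(* Let $\tau>0$ be a constant. For each $n\ge 2$ let $H_n$ be an $n\times n$ singular positive semidefinite (Hermitian) matrix whose eigenvalue $0$ has multiplicity exactly one, with eigenvalues $\lambda_1(H_n)\ge\dots\ge\lambda_{n-1}(H_n)>\lambda_n(H_n)=0$. Assume that $\lambda_{n-1}(H_n)\gg\log n$, i.e. $\lim_{n\to\infty}\lambda_{n-1}(H_n)/\log n=\infty$. Then $$S(\varrho_{H_n}^\tau)=o(1)\qquad (n\to\infty).$$
   Context: For a Hermitian matrix $H$ and real $\tau$, the Gibbs state is $\varrho_H^\tau=\exp(-\tau H)/Z$ with $Z=\mathrm{Tr}(\exp(-\tau H))$. The von Neumann entropy of a density matrix $\varrho$ is $S(\varrho)=-\mathrm{Tr}(\varrho\log\varrho)$, where $\log$ is the natural logarithm. $o(1)$ denotes a sequence converging to $0$. *)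

theory Defs
  imports "Jordan_Normal_Form.Schur_Decomposition" "Jordan_Normal_Form.Char_Poly"
begin

definition hermitian :: "complex mat \<Rightarrow> bool" where
  "hermitian A \<longleftrightarrow> mat_adjoint A = A"

definition psd :: "complex mat \<Rightarrow> bool" where
  "psd A \<longleftrightarrow> hermitian A \<and> (\<forall>v \<in> carrier_vec (dim_row A). 0 \<le> Re ((A *\<^sub>v v) \<bullet>c v))"

definition mat_trace :: "complex mat \<Rightarrow> complex" where
  "mat_trace A = (\<Sum>i<dim_row A. A $$ (i,i))"

text \<open>The \<open>k\<close>-th largest eigenvalue (\<open>k \<ge> 1\<close>), counted with multiplicity. Taking real parts
  changes nothing for Hermitian matrices, the only ones it is meant for.\<close>

definition eigval :: "complex mat \<Rightarrow> nat \<Rightarrow> real" where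
  "eigval A k = rev (sorted_list_of_multiset (image_mset Re (proots (char_poly A)))) ! (k - 1)"

definition mat_exp :: "complex mat \<Rightarrow> complex mat" where
  "mat_exp A = mat (dim_row A) (dim_row A) (\<lambda>(i,j). \<Sum>k. (A ^\<^sub>m k) $$ (i,j) / fact k)"

definition unitary_mat :: "nat \<Rightarrow> complex mat \<Rightarrow> bool" where
  "unitary_mat n U \<longleftrightarrow> U \<in> carrier_mat n n \<and> U * mat_adjoint U = 1\<^sub>m n \<and> mat_adjoint U * U = 1\<^sub>m n"

abbreviation real_diag :: "nat \<Rightarrow> (nat \<Rightarrow> real) \<Rightarrow> complex mat" where
  "real_diag n d \<equiv> mat_diag n (\<lambda>i. complex_of_real (d i))"

text \<open>Spectral functional calculus for Hermitian matrices: diagonalise and apply \<open>f\<close> to the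
  eigenvalues. The choice is immaterial by \<open>mat_fun_eq\<close> below.\<close>

definition mat_fun :: "(real \<Rightarrow> real) \<Rightarrow> complex mat \<Rightarrow> complex mat" where
  "mat_fun f A = (SOME B. \<exists>U d. unitary_mat (dim_row A) U \<and>
     A = U * real_diag (dim_row A) d * mat_adjoint U \<and>
     B = U * real_diag (dim_row A) (f \<circ> d) * mat_adjoint U)"

lemma adjoint_carrier: "U \<in> carrier_mat n n \<Longrightarrow> mat_adjoint U \<in> carrier_mat n n"
  unfolding mat_adjoint_def by auto

lemma diagonalisation_unique:
  assumes U: "unitary_mat n U" and V: "unitary_mat n V"
    and eq: "U * real_diag n d * mat_adjoint U = V * real_diag n e * mat_adjoint V"
  shows "U * real_diag n (f \<circ> d) * mat_adjoint U = V * real_diag n (f \<circ> e) * mat_adjoint V"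
proof -
  define U' V' where "U' = mat_adjoint U" and "V' = mat_adjoint V"
  have c: "U \<in> carrier_mat n n" "V \<in> carrier_mat n n" "U' \<in> carrier_mat n n" "V' \<in> carrier_mat n n"
    using U V adjoint_carrier by (auto simp: unitary_mat_def U'_def V'_def)
  have u: "U' * U = 1\<^sub>m n" "U * U' = 1\<^sub>m n" "V' * V = 1\<^sub>m n" "V * V' = 1\<^sub>m n"
    using U V by (auto simp: unitary_mat_def U'_def V'_def)
  define W where "W = V' * U"
  have W: "W \<in> carrier_mat n n" using c by (auto simp: W_def)
  let ?D = "real_diag n d" and ?E = "real_diag n e"
  let ?fD = "real_diag n (f \<circ> d)" and ?fE = "real_diag n (f \<circ> e)"
  have assoc: "X * Y * Z = X * (Y * Z)"
    if "X \<in> carrier_mat n n" "Y \<in> carrier_mat n n" "Z \<in> carrier_mat n n" for X Y Z :: "complex mat"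
    using that by (rule assoc_mult_mat)
  have mc: "X * Y \<in> carrier_mat n n"
    if "X \<in> carrier_mat n n" "Y \<in> carrier_mat n n" for X Y :: "complex mat"
    using that by auto
  have can: "U' * (U * X) = X" "U * (U' * X) = X" "V' * (V * X) = X" "V * (V' * X) = X"
    if "X \<in> carrier_mat n n" for X
    using that c u by (metis assoc left_mult_one_mat)+
  have eq': "U * (?D * U') = V * (?E * V')"
    using eq c by (simp add: assoc mc U'_def[symmetric] V'_def[symmetric])
  have "W * ?D = V' * ((U * (?D * U')) * U)"
    using c u by (simp add: W_def assoc mc right_mult_one_mat[of _ n n])
  also have "\<dots> = ?E * W"
    unfolding eq' using c by (simp add: W_def assoc mc can)
  finally have WD: "W * ?D = ?E * W" .
  have ent: "W $$ (i,j) * complex_of_real (d j) = complex_of_real (e i) * W $$ (i,j)"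
    if "i < n" "j < n" for i j
    using arg_cong[OF WD, of "\<lambda>M. M $$ (i,j)"] that
    by (simp add: mat_diag_mult_left[OF W] mat_diag_mult_right[OF W])
  have "W $$ (i,j) * complex_of_real (f (d j)) = complex_of_real (f (e i)) * W $$ (i,j)"
    if "i < n" "j < n" for i j
    using ent[OF that] by (cases "W $$ (i,j) = 0") auto
  hence WfD: "W * ?fD = ?fE * W"
    by (auto simp: mat_diag_mult_left[OF W] mat_diag_mult_right[OF W] intro!: eq_matI)
  have "U * ?fD * U' = V * (W * ?fD) * U'"
    using c by (simp add: W_def assoc mc can)
  also have "\<dots> = V * ?fE * V'"
    unfolding WfD using c u by (simp add: W_def assoc mc right_mult_one_mat[of _ n n])
  finally show ?thesis by (simp add: U'_def V'_def)
qed

lemma mat_fun_eq: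
  assumes "unitary_mat n U" and A: "A = U * real_diag n d * mat_adjoint U"
  shows "mat_fun f A = U * real_diag n (f \<circ> d) * mat_adjoint U"
proof -
  have n: "dim_row A = n" using assms by (auto simp: unitary_mat_def)
  have "\<exists>B U d. unitary_mat n U \<and> A = U * real_diag n d * mat_adjoint U \<and>
     B = U * real_diag n (f \<circ> d) * mat_adjoint U"
    by (intro exI conjI) (rule assms refl)+
  from someI_ex[OF this] obtain V e where "unitary_mat n V"
     "A = V * real_diag n e * mat_adjoint V"
     "mat_fun f A = V * real_diag n (f \<circ> e) * mat_adjoint V"
    unfolding mat_fun_def n by blast
  with diagonalisation_unique[of n U V d e f] assms show ?thesis by simp
qed

definition gibbs_state :: "real \<Rightarrow> complex mat \<Rightarrow> complex mat" where
  "gibbs_state \<tau> H = (let E = mat_exp (complex_of_real (- \<tau>) \<cdot>\<^sub>m H) in (1 / mat_trace E) \<cdot>\<^sub>m E)"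

text \<open>Since \<open>\<rho> log \<rho>\<close> multiplies \<open>log p\<close> by the same eigenvalue \<open>p\<close>, the convention
  \<open>0 log 0 = 0\<close> holds whatever value \<open>ln\<close> takes at \<open>0\<close>. The value is kept as the complex trace,
  which is real for Hermitian \<open>\<rho>\<close>.\<close>

definition vn_entropy :: "complex mat \<Rightarrow> complex" where
  "vn_entropy \<rho> = - mat_trace (\<rho> * mat_fun ln \<rho>)"

end

theory Submission
  imports Defs
begin

text \<open>
  In an eigenbasis of \<open>H n\<close>, with eigenvalues \<open>d i\<close>, the Gibbs state is diagonal with the Boltzmann
  weights \<open>p i = exp (- \<tau> * d i) / Z\<close>, so its von Neumann entropy is the Shannon entropy of \<open>p\<close>, which
  equals \<open>ln Z + (\<Sum>i<n. \<tau> * d i * p i)\<close>. Exactly one eigenvalue vanishes, and it contributes \<open>1\<close>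
  to \<open>Z\<close> and nothing to the energy term. Each of the other \<open>n - 1\<close> eigenvalues is at least the
  spectral gap \<open>g\<close>, and it adds at most \<open>exp (- \<tau> * g / 2)\<close> to each of the two terms: to the first
  because \<open>ln Z \<le> Z - 1\<close>, and to the second because \<open>Z \<ge> 1\<close> and \<open>x * exp (- x) \<le> exp (- x / 2)\<close>.
  Hence the entropy is at most \<open>2 * n * exp (- \<tau> * g / 2)\<close> (lemma \<open>gibbs_entropy_bound\<close>). As soon
  as \<open>g \<ge> (4 / \<tau>) * ln n\<close>, this is at most \<open>2 / n\<close>. So a gap larger than \<open>ln n\<close> by a suitable
  constant factor makes the exponential decay win against the number of excited levels.

  Two linear-algebra facts connect this computation with the matrices. The spectral theorem
  (\<open>hermitian_diagonalisable\<close>) provides the eigenbasis, in which powers, traces and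
  exponentials can be computed on the diagonal. The characteristic polynomial identifies the
  diagonal with the sorted list of eigenvalues, and thereby \<open>g\<close> with \<open>eigval (H n) (n - 1)\<close>
  (\<open>simple_zero_eigenvalue_gap\<close>).
\<close>

section \<open>Adjoints and unitary matrices\<close>

lemma dim_mat_adjoint [simp]:
  "dim_row (mat_adjoint A) = dim_col A" "dim_col (mat_adjoint A) = dim_row A"
  by (auto simp: mat_adjoint_def)

lemma mat_adjoint_index:
  fixes A :: "complex mat"
  assumes "i < dim_col A" "j < dim_row A"
  shows "mat_adjoint A $$ (i,j) = cnj (A $$ (j,i))"
  using assms by (simp add: mat_adjoint_def mat_of_rows_index)

lemma mat_adjoint_mult:
  fixes A B :: "complex mat"
  assumes "A \<in> carrier_mat n m" "B \<in> carrier_mat m k"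
  shows "mat_adjoint (A * B) = mat_adjoint B * mat_adjoint A"
  using assms
  by (intro eq_matI) (auto simp: mat_adjoint_index scalar_prod_def mult.commute intro!: sum.cong)

lemma conjugation_mult:
  fixes W V D :: "complex mat"
  assumes "W \<in> carrier_mat n n" "V \<in> carrier_mat n n" "D \<in> carrier_mat n n"
  shows "W * (V * D * mat_adjoint V) * mat_adjoint W = (W * V) * D * mat_adjoint (W * V)"
  using assms adjoint_carrier[OF assms(1)] adjoint_carrier[OF assms(2)]
  by (simp add: mat_adjoint_mult[of _ n n _ n] assoc_mult_mat[of _ n n _ n _ n])

lemma mat_adjoint_adjoint:
  fixes A :: "complex mat"
  shows "mat_adjoint (mat_adjoint A) = A"
  by (intro eq_matI) (auto simp: mat_adjoint_index)

lemma unitary_matD: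
  assumes "unitary_mat n U"
  shows "U \<in> carrier_mat n n" "mat_adjoint U \<in> carrier_mat n n"
    "U * mat_adjoint U = 1\<^sub>m n" "mat_adjoint U * U = 1\<^sub>m n"
  using assms adjoint_carrier by (auto simp: unitary_mat_def)

lemma unitary_matI:
  assumes U: "U \<in> carrier_mat n n" and "mat_adjoint U * U = 1\<^sub>m n"
  shows "unitary_mat n U"
  using assms mat_mult_left_right_inverse[OF adjoint_carrier[OF U] U] by (auto simp: unitary_mat_def)

lemma unitary_mat_mult:
  assumes U: "unitary_mat n U" and V: "unitary_mat n V"
  shows "unitary_mat n (U * V)"
proof (rule unitary_matI)
  note c = unitary_matD(1,2)[OF U] unitary_matD(1,2)[OF V]
  show "U * V \<in> carrier_mat n n" using c by simp
  have "mat_adjoint (U * V) * (U * V) = mat_adjoint V * ((mat_adjoint U * U) * V)"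
    using c by (simp add: mat_adjoint_mult[of _ n n _ n] assoc_mult_mat[of _ n n _ n _ n])
  also have "\<dots> = 1\<^sub>m n"
    using c left_mult_one_mat[OF c(3)] by (simp only: unitary_matD(4)[OF U] unitary_matD(4)[OF V])
  finally show "mat_adjoint (U * V) * (U * V) = 1\<^sub>m n" .
qed

text \<open>A nonzero vector extends to a basis starting with it. Gram--Schmidt keeps the first vector and
  makes the basis orthogonal, so after normalising it forms the columns of a unitary matrix. The
  factor \<open>c\<close> is the one that normalises \<open>v\<close>.\<close>

lemma unitary_mat_first_column:
  assumes v: "v \<in> carrier_vec n" and v0: "v \<noteq> 0\<^sub>v n"
  obtains W c where "unitary_mat n W" "col W 0 = c \<cdot>\<^sub>v (v :: complex vec)"
proof -
  interpret cof_vec_space n "TYPE(complex)" .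
  have n: "n > 0"
    using v v0 by (cases n) auto
  define b where "b = basis_completion v"
  from basis_completion[OF v v0, folded b_def]
  have dist_b: "distinct b" and indep: "\<not> lin_dep (set b)"
    and b: "set b \<subseteq> carrier_vec n" and hdb: "hd b = v" and len_b: "length b = n" by auto
  from hdb len_b n obtain vs where bv: "b = v # vs" by (cases b) auto
  define ws where "ws = gram_schmidt n b"
  from gram_schmidt_result[OF b dist_b indep refl, folded ws_def]
  have ws: "set ws \<subseteq> carrier_vec n" "corthogonal ws" "length ws = n"
    by (auto simp: len_b)
  from gram_schmidt_hd[OF v, of vs, folded bv] have hdws: "hd ws = v" unfolding ws_def .
  have ws0: "ws ! 0 = v" using hdws ws(3) n by (cases ws) auto
  have wsc: "ws ! i \<in> carrier_vec n" if "i < n" for i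
    using ws that by (metis nth_mem subsetD)
  define r where "r i = 1 / complex_of_real (sqrt (Re (ws ! i \<bullet>c ws ! i)))" for i
  have norm: "cnj (r i) * r i * (ws ! i \<bullet>c ws ! i) = 1" if i: "i < n" for i
  proof -
    let ?z = "ws ! i \<bullet>c ws ! i"
    have "?z \<noteq> 0" using corthogonalD[OF ws(2), of i i] ws(3) i by simp
    moreover have "?z \<ge> 0" by (rule conjugate_square_ge_0_vec)
    ultimately have z: "?z = complex_of_real (Re ?z)" and pos: "Re ?z > 0"
      by (auto simp: less_eq_complex_def complex_eq_iff less_le)
    have "complex_of_real (sqrt (Re ?z)) * complex_of_real (sqrt (Re ?z)) = ?z"
      using pos z by (simp flip: of_real_mult)
    with pos show ?thesis by (simp add: r_def field_simps \<open>?z \<noteq> 0\<close>)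
  qed
  define W where "W = mat n n (\<lambda>(i,j). r j * ws ! j $ i)"
  have W: "W \<in> carrier_mat n n" by (simp add: W_def)
  have "mat_adjoint W * W = 1\<^sub>m n"
  proof (intro eq_matI)
    fix i j assume "i < dim_row (1\<^sub>m n :: complex mat)" "j < dim_col (1\<^sub>m n :: complex mat)"
    hence ij: "i < n" "j < n" by auto
    have "(mat_adjoint W * W) $$ (i,j) = (\<Sum>k<n. cnj (r i * ws ! i $ k) * (r j * ws ! j $ k))"
      using ij by (simp add: W_def scalar_prod_def mat_adjoint_index atLeast0LessThan)
    also have "\<dots> = cnj (r i) * r j * (ws ! j \<bullet>c ws ! i)"
      using ij wsc[of i] wsc[of j] carrier_vecD[OF wsc[of i]]
      by (simp add: scalar_prod_def sum_distrib_left atLeast0LessThan mult_ac)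
    also have "\<dots> = 1\<^sub>m n $$ (i,j)"
      using ij norm corthogonalD[OF ws(2), of j i] ws(3) by (cases "i = j") auto
    finally show "(mat_adjoint W * W) $$ (i,j) = 1\<^sub>m n $$ (i,j)" .
  qed (auto simp: W_def)
  with W have "unitary_mat n W" by (rule unitary_matI)
  moreover have "col W 0 = r 0 \<cdot>\<^sub>v v"
    using n v ws0 by (intro eq_vecI) (auto simp: W_def)
  ultimately show ?thesis using that by blast
qed

section \<open>The spectral theorem\<close>

lemma mult_block_diagonal:
  fixes A :: "'a :: comm_ring_1 mat"
  assumes "A \<in> carrier_mat k k" "C \<in> carrier_mat k k" "B \<in> carrier_mat m m" "D \<in> carrier_mat m m"
  shows "four_block_mat A (0\<^sub>m k m) (0\<^sub>m m k) B * four_block_mat C (0\<^sub>m k m) (0\<^sub>m m k) D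
       = four_block_mat (A * C) (0\<^sub>m k m) (0\<^sub>m m k) (B * D)"
  using assms by (subst mult_four_block_mat[of _ k k _ m _ m _ _ k _ m]) auto

lemma unitary_mat_block:
  assumes U: "unitary_mat m U"
  defines "V \<equiv> four_block_mat (1\<^sub>m 1) (0\<^sub>m 1 m) (0\<^sub>m m 1) U"
  shows "unitary_mat (Suc m) V"
    and "mat_adjoint V = four_block_mat (1\<^sub>m 1) (0\<^sub>m 1 m) (0\<^sub>m m 1) (mat_adjoint U)"
proof -
  note c = unitary_matD(1,2)[OF U]
  show adj: "mat_adjoint V = four_block_mat (1\<^sub>m 1) (0\<^sub>m 1 m) (0\<^sub>m m 1) (mat_adjoint U)"
    using c by (intro eq_matI) (auto simp: V_def mat_adjoint_index)
  have "mat_adjoint V * V = four_block_mat (1\<^sub>m 1) (0\<^sub>m 1 m) (0\<^sub>m m 1) (1\<^sub>m m)"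
    unfolding adj unfolding V_def using c unitary_matD(4)[OF U]
    by (simp add: mult_block_diagonal)
  also have "\<dots> = 1\<^sub>m (Suc m)"
    by (intro eq_matI) auto
  finally have inv: "mat_adjoint V * V = 1\<^sub>m (Suc m)" .
  have "V \<in> carrier_mat (Suc m) (Suc m)" 
    unfolding V_def using four_block_carrier_mat[OF one_carrier_mat[of 1] c(1)] by simp
  thus "unitary_mat (Suc m) V" using inv by (rule unitary_matI)
qed

text \<open>Induction on the dimension. In an orthonormal basis that starts with an eigenvector, the first
  column of the matrix vanishes below the diagonal. The change of basis is unitary and so preserves
  hermiticity; hence the first row vanishes as well, and the remaining block, being Hermitian of
  smaller size, is diagonalised by the induction hypothesis.\<close>

theorem hermitian_diagonalisable:
  assumes "A \<in> carrier_mat n n" "hermitian A"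
  shows "\<exists>U d. unitary_mat n U \<and> A = U * real_diag n d * mat_adjoint U"
  using assms
proof (induction n arbitrary: A)
  case 0
  have "unitary_mat 0 (1\<^sub>m 0)" by (rule unitary_matI) auto
  moreover have "A = 1\<^sub>m 0 * real_diag 0 (\<lambda>_. 0) * mat_adjoint (1\<^sub>m 0)"
    using 0 by (intro eq_matI) auto
  ultimately show ?case by (intro exI conjI)
next
  case (Suc m)
  let ?n = "Suc m"
  note A = Suc.prems(1)
  have "degree (char_poly A) = ?n" using degree_monic_char_poly[OF A] by simp
  hence "\<not> constant (poly (char_poly A))" by (simp add: constant_degree)
  from fundamental_theorem_of_algebra[OF this] obtain e where "poly (char_poly A) e = 0" by blast
  hence "eigenvalue A e" using eigenvalue_root_char_poly[OF A] by simp
  then obtain v where v: "v \<in> carrier_vec ?n" "v \<noteq> 0\<^sub>v ?n" "A *\<^sub>v v = e \<cdot>\<^sub>v v"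
    using A by (auto simp: eigenvalue_def eigenvector_def)
  obtain W c where W: "unitary_mat ?n W" and W0: "col W 0 = c \<cdot>\<^sub>v v"
    using unitary_mat_first_column[OF v(1,2)] .
  define W' where "W' = mat_adjoint W"
  have cW: "W \<in> carrier_mat ?n ?n" "W' \<in> carrier_mat ?n ?n"
    and WW: "W * W' = 1\<^sub>m ?n" "W' * W = 1\<^sub>m ?n"
    using unitary_matD[OF W] by (auto simp: W'_def)
  \<comment> \<open>\<open>A\<close> in the new basis: it is Hermitian, and its first column is \<open>e\<close> times the first unit vector.\<close>
  define B where "B = W' * (A * W)"
  have B: "B \<in> carrier_mat ?n ?n" using A cW by (simp add: B_def)
  have BA: "W * B * W' = A"
  proof -
    have "W * B * W' = (W * W') * (A * (W * W'))"
      using A cW by (simp add: B_def assoc_mult_mat[of _ ?n ?n _ ?n _ ?n])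
    thus ?thesis using A WW by simp
  qed
  have "mat_adjoint B = B"
    using A cW Suc.prems(2)
    by (simp add: B_def W'_def hermitian_def mat_adjoint_mult[of _ ?n ?n _ ?n] mat_adjoint_adjoint
        assoc_mult_mat[of _ ?n ?n _ ?n _ ?n])
  hence herm: "B $$ (i,j) = cnj (B $$ (j,i))" if "i < ?n" "j < ?n" for i j
    using mat_adjoint_index[of i B j] B that by simp
  have "col (A * W) 0 = A *\<^sub>v (c \<cdot>\<^sub>v v)"
    using col_mult2[OF A cW(1), of 0] by (simp only: W0)
  also have "\<dots> = c \<cdot>\<^sub>v (e \<cdot>\<^sub>v v)"
    by (simp only: mult_mat_vec[OF A v(1)] v(3))
  finally have "col (A * W) 0 = e \<cdot>\<^sub>v col W 0"
    by (simp only: W0 smult_smult_assoc mult.commute)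
  hence B0: "B $$ (i,0) = e * 1\<^sub>m ?n $$ (i,0)" if "i < ?n" for i
    unfolding WW(2)[symmetric] using that A cW by (simp add: B_def)
  define B' where "B' = mat m m (\<lambda>(i,j). B $$ (Suc i, Suc j))"
  have "hermitian B'"
    unfolding hermitian_def by (intro eq_matI) (auto simp: B'_def mat_adjoint_index herm[symmetric])
  then obtain U d where U: "unitary_mat m U" and BU: "B' = U * real_diag m d * mat_adjoint U"
    using Suc.IH[of B'] by (auto simp: B'_def)
  define V where "V = four_block_mat (1\<^sub>m 1) (0\<^sub>m 1 m) (0\<^sub>m m 1) U"
  note V = unitary_mat_block[OF U, folded V_def]
  define d' where "d' = case_nat (Re (B $$ (0,0))) d"
  let ?E = "real_diag 1 (\<lambda>_. Re (B $$ (0,0)))"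
  let ?R = "four_block_mat ?E (0\<^sub>m 1 m) (0\<^sub>m m 1) (real_diag m d)"
  have D: "real_diag ?n d' = ?R"
  proof (intro eq_matI)
    fix i j assume "i < dim_row ?R" "j < dim_col ?R"
    thus "real_diag ?n d' $$ (i,j) = ?R $$ (i,j)"
      by (cases i; cases j) (simp_all add: mat_diag_def d'_def)
  qed (simp_all add: mat_diag_def)
  note cU = unitary_matD(1,2)[OF U]
  have "V * real_diag ?n d' * mat_adjoint V
      = four_block_mat (1\<^sub>m 1 * ?E * 1\<^sub>m 1) (0\<^sub>m 1 m) (0\<^sub>m m 1) (U * real_diag m d * mat_adjoint U)"
    unfolding D V(2) unfolding V_def
    by (simp only: mult_block_diagonal[OF one_carrier_mat mat_diag_dim cU(1) mat_diag_dim]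
        mult_block_diagonal[OF mult_carrier_mat[OF one_carrier_mat mat_diag_dim] one_carrier_mat
          mult_carrier_mat[OF cU(1) mat_diag_dim] cU(2)])
  also have "\<dots> = four_block_mat ?E (0\<^sub>m 1 m) (0\<^sub>m m 1) B'"
    by (simp only: BU left_mult_one_mat[OF mat_diag_dim] right_mult_one_mat[OF mat_diag_dim])
  also have "\<dots> = B"
  proof (intro eq_matI)
    fix i j assume "i < dim_row B" "j < dim_col B"
    hence ij: "i < ?n" "j < ?n" using B by auto
    have "cnj (B $$ (0,0)) = B $$ (0,0)" using herm[of 0 0] by simp
    hence "complex_of_real (Re (B $$ (0,0))) = B $$ (0,0)"
      by (simp add: complex_eq_iff)
    moreover have "B $$ (0,j) = 0" if "j \<noteq> 0" using herm[of 0 j] B0[of j] ij that by simp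
    moreover have "B $$ (i,0) = 0" if "i \<noteq> 0" using B0[of i] ij that by simp
    ultimately show "four_block_mat ?E (0\<^sub>m 1 m) (0\<^sub>m m 1) B' $$ (i,j) = B $$ (i,j)"
      using ij by (auto simp: mat_diag_def B'_def)
  qed (use B in \<open>auto simp: B'_def mat_diag_def\<close>)
  finally have VB: "V * real_diag ?n d' * mat_adjoint V = B" .
  have "W * (V * real_diag ?n d' * mat_adjoint V) * mat_adjoint W
      = (W * V) * real_diag ?n d' * mat_adjoint (W * V)"
    by (rule conjugation_mult[OF unitary_matD(1)[OF W] unitary_matD(1)[OF V(1)] mat_diag_dim])
  hence "A = (W * V) * real_diag ?n d' * mat_adjoint (W * V)"
    unfolding VB W'_def[symmetric] BA .
  with unitary_mat_mult[OF W V(1)] show ?case by (intro exI conjI)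
qed

section \<open>Matrix functions in an eigenbasis\<close>

text \<open>The matrices \<open>U * mat_diag n f * mat_adjoint U\<close> with a fixed unitary \<open>U\<close> form an algebra on
  which every operation in the definition of the Gibbs state and of its entropy acts pointwise on
  \<open>f\<close>.\<close>

lemma conjugated_diag_index:
  fixes U :: "complex mat"
  assumes "U \<in> carrier_mat n n" "i < n" "j < n"
  shows "(U * mat_diag n f * mat_adjoint U) $$ (i,j) = (\<Sum>l<n. U $$ (i,l) * f l * cnj (U $$ (j,l)))"
  using assms
  by (simp add: mat_diag_mult_right[OF assms(1)] scalar_prod_def mat_adjoint_index atLeast0LessThan)

lemma conjugated_diag_carrier:
  assumes "unitary_mat n U"
  shows "U * mat_diag n f * mat_adjoint U \<in> carrier_mat n n"
  by (rule mult_carrier_mat[OF mult_carrier_mat[OF unitary_matD(1)[OF assms] mat_diag_dim] unitary_matD(2)[OF assms]])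

lemma smult_conjugated_diag:
  fixes U :: "complex mat"
  assumes "U \<in> carrier_mat n n"
  shows "c \<cdot>\<^sub>m (U * mat_diag n f * mat_adjoint U) = U * mat_diag n (\<lambda>i. c * f i) * mat_adjoint U"
proof (intro eq_matI)
  note [simp] = carrier_matD[OF assms]
  fix i j assume "i < dim_row (U * mat_diag n (\<lambda>i. c * f i) * mat_adjoint U)"
    "j < dim_col (U * mat_diag n (\<lambda>i. c * f i) * mat_adjoint U)"
  hence "i < n" "j < n" by simp_all
  thus "(c \<cdot>\<^sub>m (U * mat_diag n f * mat_adjoint U)) $$ (i,j) = (U * mat_diag n (\<lambda>i. c * f i) * mat_adjoint U) $$ (i,j)"
    by (simp add: conjugated_diag_index[OF assms] sum_distrib_left mult_ac del: index_mult_mat(1))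
qed (use assms in simp_all)

lemma mult_conjugated_diag:
  assumes U: "unitary_mat n U"
  shows "(U * mat_diag n f * mat_adjoint U) * (U * mat_diag n g * mat_adjoint U)
       = U * mat_diag n (\<lambda>i. f i * g i) * mat_adjoint U"
proof -
  note c = unitary_matD(1,2)[OF U]
  define F G where "F = mat_diag n f" and "G = mat_diag n g"
  have FG: "F \<in> carrier_mat n n" "G \<in> carrier_mat n n" by (simp_all add: F_def G_def)
  have "(U * F * mat_adjoint U) * (U * G * mat_adjoint U)
      = U * (F * ((mat_adjoint U * U) * (G * mat_adjoint U)))"
    using c FG by (simp add: assoc_mult_mat[of _ n n _ n _ n])
  also have "\<dots> = U * (F * (G * mat_adjoint U))"
    using c FG by (simp only: unitary_matD(4)[OF U] left_mult_one_mat[OF mult_carrier_mat[OF FG(2) c(2)]])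
  also have "\<dots> = U * (F * G) * mat_adjoint U"
    using c FG by (simp add: assoc_mult_mat[of _ n n _ n _ n])
  finally show ?thesis by (simp add: F_def G_def)
qed

lemma pow_conjugated_diag:
  assumes U: "unitary_mat n U"
  shows "(U * mat_diag n f * mat_adjoint U) ^\<^sub>m k = U * mat_diag n (\<lambda>i. f i ^ k) * mat_adjoint U"
proof (induction k)
  case 0
  have "dim_row (U * mat_diag n f * mat_adjoint U) = n"
    using unitary_matD(1)[OF U] by simp
  moreover have "U * 1\<^sub>m n = U" using unitary_matD(1)[OF U] by simp
  ultimately show ?case by (simp add: unitary_matD(3)[OF U])
next
  case (Suc k)
  thus ?case by (simp add: mult_conjugated_diag[OF U] mult.commute)
qed

lemma mat_trace_conjugated_diag:
  assumes U: "unitary_mat n U"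
  shows "mat_trace (U * mat_diag n f * mat_adjoint U) = (\<Sum>l<n. f l)"
proof -
  note c = unitary_matD(1,2)[OF U]
  have "mat_trace (U * mat_diag n f * mat_adjoint U)
      = (\<Sum>i<n. \<Sum>l<n. U $$ (i,l) * f l * cnj (U $$ (i,l)))"
    using c by (simp add: mat_trace_def conjugated_diag_index[OF c(1)] del: index_mult_mat(1))
  also have "\<dots> = (\<Sum>l<n. \<Sum>i<n. f l * (cnj (U $$ (i,l)) * U $$ (i,l)))"
    by (subst sum.swap) (simp add: mult_ac)
  also have "\<dots> = (\<Sum>l<n. f l * (mat_adjoint U * U) $$ (l,l))"
    using c by (simp add: scalar_prod_def mat_adjoint_index sum_distrib_left atLeast0LessThan)
  also have "\<dots> = (\<Sum>l<n. f l)"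
    by (simp add: unitary_matD(4)[OF U])
  finally show ?thesis .
qed

text \<open>An entry of a power of the matrix is a finite linear combination, with coefficients independent
  of the exponent, of powers of the \<open>f l\<close>; the exponential series can therefore be summed term by
  term.\<close>

lemma mat_exp_conjugated_diag:
  assumes U: "unitary_mat n U"
  shows "mat_exp (U * mat_diag n f * mat_adjoint U) = U * mat_diag n (\<lambda>i. exp (f i)) * mat_adjoint U"
proof (intro eq_matI)
  let ?A = "U * mat_diag n f * mat_adjoint U" and ?E = "U * mat_diag n (\<lambda>i. exp (f i)) * mat_adjoint U"
  note c = unitary_matD(1,2)[OF U]
  note [simp] = carrier_matD[OF c(1)]
  fix i j assume "i < dim_row ?E" "j < dim_col ?E"
  hence ij: "i < n" "j < n" by simp_all
  have "(\<lambda>k. \<Sum>l<n. U $$ (i,l) * (f l ^ k /\<^sub>R fact k) * cnj (U $$ (j,l)))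
      sums (\<Sum>l<n. U $$ (i,l) * exp (f l) * cnj (U $$ (j,l)))"
    by (intro sums_sum sums_mult sums_mult2 exp_converges)
  moreover have "(?A ^\<^sub>m k) $$ (i,j) / fact k = (\<Sum>l<n. U $$ (i,l) * (f l ^ k /\<^sub>R fact k) * cnj (U $$ (j,l)))" for k
    using ij by (simp add: pow_conjugated_diag[OF U] conjugated_diag_index[OF c(1)] sum_divide_distrib
        scaleR_conv_of_real divide_simps mult_ac del: index_mult_mat(1))
  ultimately have "(\<lambda>k. (?A ^\<^sub>m k) $$ (i,j) / fact k) sums ?E $$ (i,j)"
    using ij by (simp add: conjugated_diag_index[OF c(1)] del: index_mult_mat(1))
  thus "mat_exp ?A $$ (i,j) = ?E $$ (i,j)"
    using ij by (simp add: mat_exp_def sums_iff del: index_mult_mat(1))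
qed (use unitary_matD(1,2)[OF U] in \<open>simp_all add: mat_exp_def\<close>)

lemma gibbs_state_conjugated_diag:
  assumes U: "unitary_mat n U"
  shows "gibbs_state \<tau> (U * real_diag n d * mat_adjoint U)
       = U * real_diag n (\<lambda>i. exp (- \<tau> * d i) / (\<Sum>l<n. exp (- \<tau> * d l))) * mat_adjoint U"
  using mat_exp_conjugated_diag[OF U, of "\<lambda>i. complex_of_real (- \<tau> * d i)"]
  by (simp add: gibbs_state_def Let_def smult_conjugated_diag[OF unitary_matD(1)[OF U]]
      mat_trace_conjugated_diag[OF U] exp_of_real flip: of_real_mult of_real_minus of_real_sum)

lemma vn_entropy_conjugated_diag:
  assumes U: "unitary_mat n U"
  shows "vn_entropy (U * real_diag n p * mat_adjoint U) = complex_of_real (- (\<Sum>i<n. p i * ln (p i)))"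
  by (simp add: vn_entropy_def mat_fun_eq[OF U refl] mult_conjugated_diag[OF U]
      mat_trace_conjugated_diag[OF U])

section \<open>The spectrum in terms of a diagonalisation\<close>

text \<open>The value of the quadratic form at the \<open>i\<close>-th column of \<open>U\<close>, a unit eigenvector, is \<open>d i\<close>.\<close>

lemma psd_diag_nonneg:
  assumes U: "unitary_mat n U" and psd: "psd (U * real_diag n d * mat_adjoint U)" and i: "i < n"
  shows "d i \<ge> 0"
proof -
  note c = unitary_matD(1,2)[OF U]
  let ?A = "U * real_diag n d * mat_adjoint U" and ?v = "col U i"
  have A: "?A \<in> carrier_mat n n" by (rule conjugated_diag_carrier[OF U])
  have D: "real_diag n d \<in> carrier_mat n n" by simp
  have "?A * U = U * real_diag n d * (mat_adjoint U * U)"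
    by (rule assoc_mult_mat[OF mult_carrier_mat[OF c(1) D] c(2) c(1)])
  also have "\<dots> = U * real_diag n d"
    unfolding unitary_matD(4)[OF U] by (rule right_mult_one_mat[OF mult_carrier_mat[OF c(1) D]])
  finally have "?A *\<^sub>v ?v = col (U * real_diag n d) i"
    using col_mult2[OF A c(1) i] by simp
  also have "\<dots> = complex_of_real (d i) \<cdot>\<^sub>v ?v"
    using c i by (intro eq_vecI) (auto simp: mat_diag_mult_right[OF c(1)])
  finally have Av: "?A *\<^sub>v ?v = complex_of_real (d i) \<cdot>\<^sub>v ?v" .
  have "?v \<bullet>c ?v = (mat_adjoint U * U) $$ (i,i)"
    using c i by (simp add: scalar_prod_def mat_adjoint_index mult.commute)
  also have "\<dots> = 1" using i by (simp add: unitary_matD(4)[OF U])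
  finally have "(?A *\<^sub>v ?v) \<bullet>c ?v = complex_of_real (d i)"
    using c i by (simp add: Av)
  moreover have "?v \<in> carrier_vec (dim_row ?A)" using c i by simp
  ultimately show ?thesis using psd unfolding psd_def by (metis complex.sel(1) Re_complex_of_real)
qed

lemma proots_char_poly_conjugated_diag:
  assumes U: "unitary_mat n U"
  shows "proots (char_poly (U * real_diag n d * mat_adjoint U)) = mset (map (\<lambda>i. complex_of_real (d i)) [0..<n])"
proof -
  note c = unitary_matD(1,2)[OF U]
  let ?A = "U * real_diag n d * mat_adjoint U"
  have "similar_mat_wit ?A (real_diag n d) U (mat_adjoint U)"
    by (rule similar_mat_witI[of _ _ n]) (use c unitary_matD(3,4)[OF U] conjugated_diag_carrier[OF U] in simp_all)
  hence "char_poly ?A = char_poly (real_diag n d)"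
    by (intro char_poly_similar) (auto simp: similar_mat_def)
  also have "\<dots> = (\<Prod>a\<leftarrow>diag_mat (real_diag n d). [:- a, 1:])"
    by (rule char_poly_upper_triangular[of _ n]) (auto simp: mat_diag_def)
  also have "diag_mat (real_diag n d) = map (\<lambda>i. complex_of_real (d i)) [0..<n]"
    by (auto simp: diag_mat_def mat_diag_def)
  finally have cp: "char_poly ?A = (\<Prod>a\<leftarrow>map (\<lambda>i. complex_of_real (d i)) [0..<n]. [:- a, 1:])" .
  have "proots (\<Prod>a\<leftarrow>xs. [:- a, 1:]) = mset xs" for xs :: "complex list"
  proof (induction xs)
    case (Cons a xs)
    have "(\<Prod>a\<leftarrow>xs. [:- a, 1:]) \<noteq> (0 :: complex poly)" by (auto simp: prod_list_zero_iff)
    hence "proots ([:- a, 1:] * (\<Prod>a\<leftarrow>xs. [:- a, 1:])) = {#a#} + mset xs"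
      using Cons by (subst proots_mult) auto
    thus ?case by simp
  qed simp
  thus ?thesis unfolding cp .
qed

lemma sorted_nth_1_le:
  fixes xs :: "real list"
  assumes "sorted xs" "\<And>x. x \<in> set xs \<Longrightarrow> x \<ge> 0" "0 \<in> set xs" "y \<in> set xs" "y \<noteq> 0"
  shows "xs ! 1 \<le> y"
proof -
  obtain j where j: "j < length xs" "xs ! j = y" using assms(4) by (auto simp: in_set_conv_nth)
  obtain k where k: "k < length xs" "xs ! k = 0" using assms(3) by (auto simp: in_set_conv_nth)
  have "xs ! 0 \<le> xs ! k" using assms(1) k by (intro sorted_nth_mono) auto
  moreover have "xs ! 0 \<ge> 0" using k by (intro assms(2) nth_mem) auto
  ultimately have "xs ! 0 = 0" using k by simp
  hence "j \<noteq> 0" using j assms(5) by (cases j) auto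
  thus ?thesis using j sorted_nth_mono[OF assms(1), of 1 j] by simp
qed

text \<open>By semidefiniteness the sorted list of the \<open>d i\<close> starts with the eigenvalue \<open>0\<close>, and
  \<open>eigval A (n - 1)\<close>, the second smallest eigenvalue, is its next entry. Since the root \<open>0\<close> is
  simple, every other \<open>d i\<close> is nonzero and so stands at this entry or later.\<close>

lemma simple_zero_eigenvalue_gap:
  assumes U: "unitary_mat n U" and n: "n \<ge> 2"
    and A: "A = U * real_diag n d * mat_adjoint U"
    and psd: "psd A" and ord: "order 0 (char_poly A) = 1"
  obtains k where "k < n" "d k = 0" "\<And>i. i < n \<Longrightarrow> i \<noteq> k \<Longrightarrow> eigval A (n - 1) \<le> d i"
proof -
  note pr = proots_char_poly_conjugated_diag[OF U, of d, folded A]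
  define xs where "xs = sort (map d [0..<n])"
  have "eigval A (n - 1) = rev xs ! (n - 2)"
    unfolding eigval_def pr xs_def
    by (simp add: multiset.map_comp comp_def numeral_2_eq_2 flip: mset_map sorted_list_of_multiset_mset)
  also have "\<dots> = xs ! 1"
    using n by (simp add: xs_def rev_nth numeral_2_eq_2 Suc_diff_Suc)
  finally have ev: "eigval A (n - 1) = xs ! 1" .
  have "A \<in> carrier_mat n n" unfolding A by (rule conjugated_diag_carrier[OF U])
  from degree_monic_char_poly[OF this] n have "char_poly A \<noteq> 0" by auto
  hence "order 0 (char_poly A) = count (proots (char_poly A)) 0" by simp
  also have "\<dots> = length (filter (\<lambda>i. d i = 0) [0..<n])"
    unfolding pr count_mset count_list_eq_length_filter filter_map length_map comp_def by (simp add: eq_commute[of "0 :: complex"])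
  also have "\<dots> = card {i. i < n \<and> d i = 0}"
    by (subst distinct_length_filter) (auto intro!: arg_cong[where f = card])
  finally have "card {i. i < n \<and> d i = 0} = 1" using ord by simp
  then obtain k where k: "{i. i < n \<and> d i = 0} = {k}" by (auto simp: card_1_singleton_iff)
  hence k0: "k < n" "d k = 0" by auto
  have "eigval A (n - 1) \<le> d i" if "i < n" "i \<noteq> k" for i
  proof -
    have "d i \<noteq> 0" using k that by auto
    thus ?thesis unfolding ev
      using psd_diag_nonneg[OF U psd[unfolded A]] k0 that
      by (intro sorted_nth_1_le) (auto simp: xs_def intro!: image_eqI[of _ _ k])
  qed
  with k0 that show ?thesis by blast
qed

section \<open>The entropy estimate\<close>

lemma le_exp_half: "x \<le> exp (x / 2)" if "x \<ge> 0" for x :: real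
proof -
  have "x \<le> (1 + x / 4)^2" using zero_le_power2[of "1 - x / 4"] by (simp add: power2_eq_square algebra_simps)
  also have "\<dots> \<le> exp (x / 4) ^ 2" using that by (intro power_mono exp_ge_add_one_self) auto
  also have "\<dots> = exp (x / 2)" by (simp flip: exp_double)
  finally show ?thesis .
qed

text \<open>Half of the decay rate is given up in order to absorb the linear factor of the energy term:
  \<open>x * exp (- x) \<le> exp (- x / 2)\<close>.\<close>

lemma gibbs_entropy_bound:
  fixes d :: "nat \<Rightarrow> real"
  assumes \<tau>: "\<tau> > 0" and k: "k < n" "d k = 0" and g: "g \<ge> 0"
    and gap: "\<And>i. i < n \<Longrightarrow> i \<noteq> k \<Longrightarrow> g \<le> d i"
  defines "p \<equiv> \<lambda>i. exp (- \<tau> * d i) / (\<Sum>l<n. exp (- \<tau> * d l))"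
  shows "0 \<le> - (\<Sum>i<n. p i * ln (p i))"
    and "- (\<Sum>i<n. p i * ln (p i)) \<le> 2 * real n * exp (- \<tau> * g / 2)"
proof -
  define Z where "Z = (\<Sum>l<n. exp (- \<tau> * d l))"
  have Zk: "Z = 1 + (\<Sum>l\<in>{..<n} - {k}. exp (- \<tau> * d l))"
    unfolding Z_def using k by (subst sum.remove[of _ k]) auto
  hence Z1: "Z \<ge> 1" by (simp add: sum_nonneg)
  have p: "p i = exp (- \<tau> * d i) / Z" for i by (simp add: p_def Z_def)
  have p_sum: "(\<Sum>i<n. p i) = 1"
  proof -
    have "(\<Sum>i<n. p i) = Z / Z" unfolding p sum_divide_distrib[symmetric] Z_def ..
    thus ?thesis using Z1 by simp
  qed
  have d0: "d i \<ge> 0" if "i < n" for i using gap[OF that] k g by (cases "i = k") auto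
  have ln_p: "ln (p i) = - \<tau> * d i - ln Z" for i
    using Z1 by (simp add: p ln_div)
  have S: "- (\<Sum>i<n. p i * ln (p i)) = ln Z + (\<Sum>i<n. \<tau> * d i * p i)"
  proof -
    have "- (\<Sum>i<n. p i * ln (p i)) = (\<Sum>i<n. \<tau> * d i * p i + p i * ln Z)"
      unfolding ln_p by (simp add: algebra_simps flip: sum_negf)
    also have "\<dots> = (\<Sum>i<n. \<tau> * d i * p i) + (\<Sum>i<n. p i) * ln Z"
      by (simp add: sum.distrib sum_distrib_right)
    finally show ?thesis by (simp add: p_sum)
  qed
  show "0 \<le> - (\<Sum>i<n. p i * ln (p i))"
    unfolding S using Z1 \<tau> d0 by (intro add_nonneg_nonneg sum_nonneg) (auto simp: p)
  have excited: "exp (- \<tau> * d i / 2) \<le> exp (- \<tau> * g / 2)" if "i < n" "i \<noteq> k" for i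
    using gap[OF that] \<tau> by simp
  have "ln Z \<le> Z - 1" using Z1 by (intro ln_le_minus_one) auto
  also have "\<dots> \<le> (\<Sum>l\<in>{..<n} - {k}. exp (- \<tau> * g / 2))"
  proof -
    have "exp (- \<tau> * d l) \<le> exp (- \<tau> * g / 2)" if "l \<in> {..<n} - {k}" for l
      using excited[of l] that mult_nonneg_nonneg[OF less_imp_le[OF \<tau>] d0[of l]] by auto
    hence "(\<Sum>l\<in>{..<n} - {k}. exp (- \<tau> * d l)) \<le> (\<Sum>l\<in>{..<n} - {k}. exp (- \<tau> * g / 2))"
      by (rule sum_mono)
    thus ?thesis unfolding Zk by linarith
  qed
  also have "\<dots> \<le> real n * exp (- \<tau> * g / 2)"
    using k by simp
  finally have 1: "ln Z \<le> real n * exp (- \<tau> * g / 2)" .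
  have "(\<Sum>i<n. \<tau> * d i * p i) \<le> (\<Sum>i<n. exp (- \<tau> * g / 2))"
  proof (intro sum_mono)
    fix i assume "i \<in> {..<n}"
    hence i: "i < n" by simp
    let ?x = "\<tau> * d i"
    show "?x * p i \<le> exp (- \<tau> * g / 2)"
    proof (cases "i = k")
      case False
      have x: "?x \<ge> 0" using \<tau> d0[OF i] by simp
      have "p i \<le> exp (- ?x)" unfolding p using Z1 by (simp add: divide_le_eq)
      hence "?x * p i \<le> exp (?x / 2) * exp (- ?x)"
        using le_exp_half[OF x] x Z1 by (intro mult_mono) (auto simp: p)
      also have "\<dots> = exp (- \<tau> * d i / 2)" by (simp flip: exp_add)
      also have "\<dots> \<le> exp (- \<tau> * g / 2)" by (rule excited[OF i False])
      finally show ?thesis .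
    qed (simp add: k)
  qed
  with 1 show "- (\<Sum>i<n. p i * ln (p i)) \<le> 2 * real n * exp (- \<tau> * g / 2)"
    unfolding S by simp
qed

theorem theorem7:
  fixes \<tau> :: real and H :: "nat \<Rightarrow> complex mat"
  assumes "\<tau> > 0"
    and "\<And>n. n \<ge> 2 \<Longrightarrow> H n \<in> carrier_mat n n"
    and "\<And>n. n \<ge> 2 \<Longrightarrow> psd (H n)"
    and "\<And>n. n \<ge> 2 \<Longrightarrow> order 0 (char_poly (H n)) = 1"
    and "filterlim (\<lambda>n. eigval (H n) (n - 1) / ln (real n)) at_top sequentially"
  shows "(\<lambda>n. vn_entropy (gibbs_state \<tau> (H n))) \<longlonglongrightarrow> 0"
proof (rule metric_tendsto_imp_tendsto)
  show "(\<lambda>n. 2 / real n) \<longlonglongrightarrow> 0" by (rule lim_const_over_n)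
  \<comment> \<open>With the factor \<open>4 / \<tau>\<close>, \<open>exp (- \<tau> * g / 2) \<le> 1 / n\<^sup>2\<close>, which beats the number \<open>n\<close> of levels.\<close>
  have "\<forall>\<^sub>F n in sequentially. 4 / \<tau> \<le> eigval (H n) (n - 1) / ln (real n)"
    using assms(5) unfolding filterlim_at_top by blast
  moreover have "\<forall>\<^sub>F n :: nat in sequentially. n \<ge> 2" by (rule eventually_ge_at_top)
  ultimately show "\<forall>\<^sub>F n in sequentially. dist (vn_entropy (gibbs_state \<tau> (H n))) 0 \<le> dist (2 / real n) 0"
  proof eventually_elim
    case (elim n)
    note n = elim(2)
    define g where "g = eigval (H n) (n - 1)"
    have ln_n: "ln (real n) > 0" using n by simp
    hence g_large: "4 / \<tau> * ln (real n) \<le> g" using elim(1) by (simp add: g_def pos_le_divide_eq)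
    hence g0: "g \<ge> 0"
      using assms(1) ln_n by (smt (verit) divide_pos_pos mult_pos_pos)
    have "\<exists>U d. unitary_mat n U \<and> H n = U * real_diag n d * mat_adjoint U"
      using hermitian_diagonalisable[OF assms(2)[OF n]] assms(3)[OF n] by (simp add: psd_def)
    then obtain U d where U: "unitary_mat n U" and HU: "H n = U * real_diag n d * mat_adjoint U"
      by blast
    obtain k where k: "k < n" "d k = 0" "\<And>i. i < n \<Longrightarrow> i \<noteq> k \<Longrightarrow> g \<le> d i"
      using simple_zero_eigenvalue_gap[OF U n HU assms(3)[OF n] assms(4)[OF n]] unfolding g_def by blast
    define p where "p = (\<lambda>i. exp (- \<tau> * d i) / (\<Sum>l<n. exp (- \<tau> * d l)))"
    have S: "vn_entropy (gibbs_state \<tau> (H n)) = complex_of_real (- (\<Sum>i<n. p i * ln (p i)))"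
      unfolding HU gibbs_state_conjugated_diag[OF U] p_def by (rule vn_entropy_conjugated_diag[OF U])
    have bound: "0 \<le> - (\<Sum>i<n. p i * ln (p i))"
      "- (\<Sum>i<n. p i * ln (p i)) \<le> 2 * real n * exp (- \<tau> * g / 2)"
      unfolding p_def using gibbs_entropy_bound[OF assms(1), of k n d g, OF k(1,2) g0 k(3)] by blast+
    have "norm (vn_entropy (gibbs_state \<tau> (H n))) = - (\<Sum>i<n. p i * ln (p i))"
      unfolding S norm_of_real using bound(1) by simp
    also have "\<dots> \<le> 2 * real n * exp (- \<tau> * g / 2)" by (rule bound(2))
    also have "\<dots> \<le> 2 * real n * exp (- (2 * ln (real n)))"
    proof (intro mult_left_mono)
      have "2 * ln (real n) \<le> \<tau> * g / 2" using g_large assms(1) by (simp add: field_simps)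
      thus "exp (- \<tau> * g / 2) \<le> exp (- (2 * ln (real n)))" by simp
    qed simp
    also have "\<dots> = 2 / real n"
      using n by (simp add: exp_minus exp_double power2_eq_square field_simps)
    finally show ?case by simp
  qed
qed

end
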